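(* Let $P|S$ be a conditional event (with $S\neq\bot$) and let $x\in\left]\tfrac12,1\right]$. Consider the sentences on the one-element sequence $\mathcal{F}=(P|S)$ given by $A(x):(P|S,[x,1])$, $E(x):(P|S,[0,1-x])$, $I(x):(P|S,\,]1-x,1])$, $O(x):(P|S,[0,x[)$. Then the quadruple $(A(x),E(x),I(x),O(x))$ is a square of opposition.
   Context: Events are two-valued logical entities (they can be modelled as subsets of a nonempty set $\Omega$ of possible cases); an event is identified with its indicator in $\{0,1\}$. A conditional event $E|H$ is given by events $E,H$ with $H\neq\bot$ (impossible event). No logical independence is assumed. Given a sequence $\mathcal{F}=(E_1|H_1,\ldots,E_n|H_n)$, a precise assessment on $\mathcal{F}$ is a vector $\mathcal{P}=(p_1,\ldots,p_n)$, $p_i=p(E_i|H_i)$. It is coherent iff for every nonempty subfamily, indexed by $J\subseteq\{1,\ldots,n\}$, and all real numbers $s_j$ ($j\in J$), the random gain $\mathcal{G}=\sum_{j\in J}s_jH_j(E_j-p_j)$ satisfies $\min G\le 0\le\max G$, where $G$ is the set of values of $\mathcal{G}$ restricted to $\bigvee_{j\in J}H_j$ being true. $\Pi$ denotes the set of all coherent precise assessments on $\mathcal{F}$; it is known that $\emptyset\neq\Pi\subseteq[0,1]^n$. Here $n=1$. For $\mathcal{I}\subseteq[0,1]^n$ write $\pi(\mathcal{I})=\Pi\cap\mathcal{I}$. A sentence is a pair $s:(\mathcal{F},\mathcal{I})$ with $\mathcal{I}\subseteq[0,1]^n$. A quadruple $(s_1,s_2,s_3,s_4)$ of sentences $s_k:(\mathcal{F},\mathcal{I}_k)$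 is a square of opposition iff: (a) (contraries) $\pi(\mathcal{I}_1)\cap\pi(\mathcal{I}_2)=\emptyset$; (b) (subcontraries) $\pi(\mathcal{I}_3)\cup\pi(\mathcal{I}_4)=\Pi$; (c) (contradictories) $\pi(\mathcal{I}_1)\cap\pi(\mathcal{I}_4)=\emptyset$, $\pi(\mathcal{I}_1)\cup\pi(\mathcal{I}_4)=\Pi$, $\pi(\mathcal{I}_2)\cap\pi(\mathcal{I}_3)=\emptyset$, $\pi(\mathcal{I}_2)\cup\pi(\mathcal{I}_3)=\Pi$; (d) (subalterns) $\pi(\mathcal{I}_1)\subseteq\pi(\mathcal{I}_3)$ and $\pi(\mathcal{I}_2)\subseteq\pi(\mathcal{I}_4)$. Notation: $]a,b]$, $[a,b[$ denote half-open intervals. *)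

theory Defs
  imports "HOL-Analysis.Analysis"
begin

text \<open>
  Events are subsets of the set of possible cases, rendered as the type \<^typ>\<open>'w\<close> (types are
  nonempty). The pair \<open>(E, H)\<close> stands for the conditional event \<open>E|H\<close>. Sequences and assessments
  are lists, so indices run over \<open>0, ..., n - 1\<close>.
\<close>

type_synonym 'w cond_event = "'w set \<times> 'w set"

definition cond_event_seq :: "'w cond_event list \<Rightarrow> bool" where
  "cond_event_seq F \<longleftrightarrow> F \<noteq> [] \<and> (\<forall>(E, H) \<in> set F. H \<noteq> {})"

definition gain ::
  "'w cond_event list \<Rightarrow> real list \<Rightarrow> nat set \<Rightarrow> (nat \<Rightarrow> real) \<Rightarrow> 'w \<Rightarrow> real" where
  "gain F p J s w =
     (\<Sum>j\<in>J. s j * indicator (snd (F ! j)) w * (indicator (fst (F ! j)) w - p ! j))"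

definition gain_values ::
  "'w cond_event list \<Rightarrow> real list \<Rightarrow> nat set \<Rightarrow> (nat \<Rightarrow> real) \<Rightarrow> real set" where
  "gain_values F p J s = gain F p J s ` (\<Union>j\<in>J. snd (F ! j))"

text \<open>
  Even over infinitely many cases a gain takes finitely many values, so \<^const>\<open>Min\<close> and
  \<^const>\<open>Max\<close> in the definition of coherence are genuine minima and maxima
  (nonemptiness holds whenever the conditioning events are nonempty).
\<close>

lemma finite_gain_values:
  assumes "finite J"
  shows "finite (gain_values F p J s)"
proof -
  let ?T = "\<lambda>w. ({j \<in> J. w \<in> snd (F ! j)}, {j \<in> J. w \<in> fst (F ! j)})"
  let ?g = "\<lambda>(A, B). \<Sum>j\<in>J. s j * indicator A j * (indicator B j - p ! j)"
  have "gain F p J s w = ?g (?T w)" for w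
    by (auto simp: gain_def indicator_def intro!: sum.cong)
  then have "gain_values F p J s \<subseteq> ?g ` (Pow J \<times> Pow J)"
    unfolding gain_values_def by blast
  then show ?thesis
    by (rule finite_subset) (simp add: assms)
qed

lemma gain_values_nonempty:
  assumes "cond_event_seq F" "J \<noteq> {}" "J \<subseteq> {..<length F}"
  shows "gain_values F p J s \<noteq> {}"
proof -
  from assms(2) obtain j where "j \<in> J" by blast
  with assms(3) have "F ! j \<in> set F" by auto
  with assms(1) have "snd (F ! j) \<noteq> {}"
    unfolding cond_event_seq_def case_prod_beta by blast
  with \<open>j \<in> J\<close> show ?thesis
    by (auto simp: gain_values_def)
qed

definition coherent :: "'w cond_event list \<Rightarrow> real list \<Rightarrow> bool" where
  "coherent F p \<longleftrightarrow> length p = length F \<and>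
     (\<forall>J s. J \<noteq> {} \<and> J \<subseteq> {..<length F} \<longrightarrow>
        Min (gain_values F p J s) \<le> 0 \<and> 0 \<le> Max (gain_values F p J s))"

definition coherent_assessments :: "'w cond_event list \<Rightarrow> real list set" where
  "coherent_assessments F = {p. coherent F p}"

type_synonym 'w sentence = "'w cond_event list \<times> real list set"

definition unit_cube :: "nat \<Rightarrow> real list set" where
  "unit_cube n = {p. length p = n \<and> set p \<subseteq> {0..1}}"

definition is_sentence :: "'w sentence \<Rightarrow> bool" where
  "is_sentence = (\<lambda>(F, I). cond_event_seq F \<and> I \<subseteq> unit_cube (length F))"

text \<open>The set \<open>\<pi>(I)\<close> of the coherent assessments in \<open>I\<close>, where \<open>I\<close> is the second component
  of the sentence.\<close>

definition coherent_part :: "'w sentence \<Rightarrow> real list set" where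
  "coherent_part = (\<lambda>(F, I). coherent_assessments F \<inter> I)"

definition square_of_opposition ::
  "'w sentence \<times> 'w sentence \<times> 'w sentence \<times> 'w sentence \<Rightarrow> bool" where
  "square_of_opposition = (\<lambda>(s1, s2, s3, s4).
     \<comment> \<open>four sentences on a common sequence\<close>
     (\<forall>s \<in> {s1, s2, s3, s4}. is_sentence s \<and> fst s = fst s1) \<and>
     \<comment> \<open>contraries\<close>
     coherent_part s1 \<inter> coherent_part s2 = {} \<and>
     \<comment> \<open>subcontraries\<close>
     coherent_part s3 \<union> coherent_part s4 = coherent_assessments (fst s1) \<and>
     \<comment> \<open>contradictories\<close>
     coherent_part s1 \<inter> coherent_part s4 = {} \<and>
     coherent_part s1 \<union> coherent_part s4 = coherent_assessments (fst s1) \<and>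
     coherent_part s2 \<inter> coherent_part s3 = {} \<and>
     coherent_part s2 \<union> coherent_part s3 = coherent_assessments (fst s1) \<and>
     \<comment> \<open>subalterns\<close>
     coherent_part s1 \<subseteq> coherent_part s3 \<and>
     coherent_part s2 \<subseteq> coherent_part s4)"

end

theory Submission
  imports Defs
begin

text \<open>
  The four intervals are chosen so that \<open>[x, 1]\<close> and \<open>[0, x[\<close>, and likewise \<open>[0, 1 - x]\<close> and
  \<open>]1 - x, 1]\<close>, partition \<open>[0, 1]\<close>; this gives the contradictories as soon as every coherent
  assessment on \<open>P|S\<close> lies in \<open>[0, 1]\<close>, and that is what coherence provides
  (lemmas \<open>coherent_nth_in_unit_interval\<close> and \<open>coherent_singleton\<close>). Since \<open>x > 1/2\<close>, that is,
  \<open>1 - x < x\<close>, the intervals of \<open>A(x)\<close> and \<open>E(x)\<close> are disjoint, those of \<open>I(x)\<close> and \<open>O(x)\<close> cover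
  \<open>[0, 1]\<close>, and the two inclusions of the subalterns hold. All relations are thus inherited from
  relations between subsets of \<open>[0, 1]\<close> by intersecting with the set of coherent assessments.
\<close>

text \<open>
  Betting the unit stake on the single conditional event \<open>E|H\<close> gains \<open>1 - p\<close> or \<open>- p\<close> when \<open>H\<close>
  is true. A negative \<open>p\<close> would make both gains positive and a \<open>p\<close> above \<open>1\<close> both negative.
\<close>

lemma coherent_nth_in_unit_interval:
  assumes F: "cond_event_seq F" and coh: "coherent F p" and j: "j < length F"
  shows "p ! j \<in> {0..1}"
proof -
  let ?V = "gain_values F p {j} (\<lambda>_. 1)"
  have J: "{j} \<noteq> {}" "{j} \<subseteq> {..<length F}"
    using j by auto
  have fin: "finite ?V" and ne: "?V \<noteq> {}"
    using finite_gain_values gain_values_nonempty[OF F J] by blast+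
  have "Min ?V \<le> 0" "0 \<le> Max ?V"
    using coh J unfolding coherent_def by blast+
  moreover have "- (p ! j) \<le> v \<and> v \<le> 1 - p ! j" if "v \<in> ?V" for v
    using that by (auto simp: gain_values_def gain_def indicator_def)
  ultimately show ?thesis
    using Min_in[OF fin ne] Max_in[OF fin ne] by fastforce
qed

lemma coherent_singleton:
  assumes "H \<noteq> {}" and "q \<in> coherent_assessments [(E, H)]"
  obtains p where "q = [p]" and "0 \<le> p" and "p \<le> 1"
proof -
  have coh: "coherent [(E, H)] q"
    using assms(2) by (simp add: coherent_assessments_def)
  then obtain p where "q = [p]"
    by (auto simp: coherent_def length_Suc_conv)
  moreover have "q ! 0 \<in> {0..1}"
    using assms(1) by (intro coherent_nth_in_unit_interval[OF _ coh]) (auto simp: cond_event_seq_def)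
  ultimately show thesis
    using that by simp
qed

theorem mainTheorem7:
  fixes P S :: "'w set" and x :: real
  assumes "S \<noteq> {}"
    and "x \<in> {1/2<..1}"
  shows "square_of_opposition
    (([(P, S)], (\<lambda>p. [p]) ` {x..1}),
     ([(P, S)], (\<lambda>p. [p]) ` {0..1 - x}),
     ([(P, S)], (\<lambda>p. [p]) ` {1 - x<..1}),
     ([(P, S)], (\<lambda>p. [p]) ` {0..<x}))"
proof -
  let ?C = "coherent_assessments [(P, S)]"
  let ?A = "(\<lambda>p::real. [p]) ` {x..1}" and ?E = "(\<lambda>p::real. [p]) ` {0..1 - x}"
  let ?I = "(\<lambda>p::real. [p]) ` {1 - x<..1}" and ?O = "(\<lambda>p::real. [p]) ` {0..<x}"
  have sentences: "is_sentence ([(P, S)], K)" if "K \<in> {?A, ?E, ?I, ?O}" for K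
    using that assms by (auto simp: is_sentence_def cond_event_seq_def unit_cube_def)
  have "?A \<inter> ?E = {}" "?A \<inter> ?O = {}" "?E \<inter> ?I = {}" "?A \<subseteq> ?I" "?E \<subseteq> ?O"
    using assms(2) by auto
  moreover have "?C \<subseteq> ?I \<union> ?O" "?C \<subseteq> ?A \<union> ?O" "?C \<subseteq> ?E \<union> ?I"
    using assms by (auto simp: image_iff elim!: coherent_singleton[OF assms(1)])
  ultimately show ?thesis
    using sentences unfolding square_of_opposition_def coherent_part_def by auto
qed

end
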